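(* Let $G$ be a finite simple undirected quasi-line graph. Then for every vertex $x \in V(G)$, $b(G-\{x\}) \geq b(G) - 2$.
   Context: A graph is quasi-line if the neighborhood of each vertex is covered by at most two cliques. A proper coloring of the vertices of a graph is a b-coloring if every color class contains a vertex adjacent to at least one vertex of every other color class. The b-chromatic number $b(G)$ is the largest integer $k$ such that $G$ admits a b-coloring with $k$ colors. $G-\{x\}$ denotes the graph obtained from $G$ by deleting $x$ and all edges incident to $x$. *)

theory Defs
  imports "Graph_Theory.Digraph"
begin

text \<open>
  A finite simple undirected graph is an instance of the locale \<^locale>\<open>graph\<close>:
  a finite digraph without loops and parallel arcs whose arc relation is symmetric.
  Adjacency is \<open>u \<rightarrow>\<^bsub>G\<^esub> v\<close>; the null graph is allowed, so that deleting the only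
  vertex of a graph gives a graph.
\<close>

definition neighborhood :: "('a, 'b) pre_digraph \<Rightarrow> 'a \<Rightarrow> 'a set" where
  "neighborhood G v = {u \<in> verts G. v \<rightarrow>\<^bsub>G\<^esub> u}"

text \<open>The empty set counts as a clique, so two cliques below means at most two.\<close>

definition clique :: "('a, 'b) pre_digraph \<Rightarrow> 'a set \<Rightarrow> bool" where
  "clique G K \<longleftrightarrow> K \<subseteq> verts G \<and> (\<forall>u\<in>K. \<forall>v\<in>K. u \<noteq> v \<longrightarrow> u \<rightarrow>\<^bsub>G\<^esub> v)"

definition quasi_line :: "('a, 'b) pre_digraph \<Rightarrow> bool" where
  "quasi_line G \<longleftrightarrow>
    (\<forall>v\<in>verts G. \<exists>K L. clique G K \<and> clique G L \<and> neighborhood G v \<subseteq> K \<union> L)"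

definition proper_coloring :: "('a, 'b) pre_digraph \<Rightarrow> nat \<Rightarrow> ('a \<Rightarrow> nat) \<Rightarrow> bool" where
  "proper_coloring G k c \<longleftrightarrow>
    (\<forall>v\<in>verts G. c v < k) \<and> (\<forall>u\<in>verts G. \<forall>v\<in>verts G. u \<rightarrow>\<^bsub>G\<^esub> v \<longrightarrow> c u \<noteq> c v)"

definition color_class :: "('a, 'b) pre_digraph \<Rightarrow> ('a \<Rightarrow> nat) \<Rightarrow> nat \<Rightarrow> 'a set" where
  "color_class G c i = {v \<in> verts G. c v = i}"

text \<open>
  The second conjunct makes each of the \<open>k\<close> classes nonempty,
  so exactly \<open>k\<close> colors are used.
\<close>

definition b_coloring :: "('a, 'b) pre_digraph \<Rightarrow> nat \<Rightarrow> ('a \<Rightarrow> nat) \<Rightarrow> bool" where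
  "b_coloring G k c \<longleftrightarrow> proper_coloring G k c \<and>
    (\<forall>i<k. \<exists>v\<in>color_class G c i. \<forall>j<k. j \<noteq> i \<longrightarrow> (\<exists>w\<in>color_class G c j. v \<rightarrow>\<^bsub>G\<^esub> w))"

definition b_chromatic :: "('a, 'b) pre_digraph \<Rightarrow> nat" where
  "b_chromatic G = Max {k. \<exists>c. b_coloring G k c}"

text \<open>
  For a finite simple graph the set in the definition of \<^const>\<open>b_chromatic\<close> is finite
  and nonempty (a proper coloring with the fewest colors is a b-coloring), so the
  maximum is attained.
\<close>

lemma b_coloring_card_le:
  assumes "finite (verts G)" "b_coloring G k c"
  shows "k \<le> card (verts G)"
proof -
  have "{..<k} \<subseteq> c ` verts G"
    using assms(2) by (auto simp: b_coloring_def color_class_def)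
  then show ?thesis
    using surj_card_le[OF assms(1)] by fastforce
qed

lemma finite_b_colorings:
  assumes "finite (verts G)"
  shows "finite {k. \<exists>c. b_coloring G k c}"
  by (rule finite_subset[of _ "{..card (verts G)}"])
    (auto dest: b_coloring_card_le[OF assms])

lemma (in graph) ex_b_coloring: "\<exists>k c. b_coloring G k c"
proof -
  have ex: "\<exists>k c. proper_coloring G k c"
  proof -
    obtain f :: "'a \<Rightarrow> nat" and n where f: "f ` verts G = {i. i < n}" "inj_on f (verts G)"
      using finite_imp_inj_to_nat_seg[OF finite_verts] by blast
    then have "proper_coloring G n f"
      using adj_not_same by (auto simp: proper_coloring_def inj_on_def)
    then show ?thesis by blast
  qed
  define k where "k = (LEAST k. \<exists>c. proper_coloring G k c)"
  obtain c where c: "proper_coloring G k c"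
    using LeastI_ex[OF ex] unfolding k_def by blast
  have "b_coloring G k c"
  proof (rule ccontr)
    assume "\<not> b_coloring G k c"
    then obtain i where i: "i < k"
      and "\<forall>v\<in>color_class G c i. \<exists>j<k. j \<noteq> i \<and> (\<forall>w\<in>color_class G c j. \<not> v \<rightarrow> w)"
      using c unfolding b_coloring_def by blast
    then obtain f where f: "\<And>v. v \<in> color_class G c i \<Longrightarrow>
        f v < k \<and> f v \<noteq> i \<and> (\<forall>w\<in>color_class G c (f v). \<not> v \<rightarrow> w)"
      by metis
    define d where "d v = (if c v = i then f v else c v)" for v
    define r where "r j = (if j = k - 1 then i else j)" for j :: nat
    have d: "d v < k" "d v \<noteq> i" if "v \<in> verts G" for v
      using that c f by (auto simp: d_def proper_coloring_def color_class_def)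
    have sym: "v \<rightarrow> u" if "u \<rightarrow> v" for u v
      using that arcs_ends_symmetric[OF sym_arcs] by blast
    have dd: "d u \<noteq> d v" if "u \<in> verts G" "v \<in> verts G" "u \<rightarrow> v" for u v
    proof -
      have c_ne: "c u \<noteq> c v"
        using that c by (auto simp: proper_coloring_def)
      show ?thesis
      proof (cases "c u = i")
        case True
        with that(1) have "\<forall>w\<in>color_class G c (f u). \<not> u \<rightarrow> w"
          using f[of u] by (simp add: color_class_def)
        with that have "c v \<noteq> f u" by (auto simp: color_class_def)
        with True c_ne show ?thesis by (simp add: d_def)
      next
        case u: False
        show ?thesis
        proof (cases "c v = i")
          case True
          with that(2) have "\<forall>w\<in>color_class G c (f v). \<not> v \<rightarrow> w"
            using f[of v] by (simp add: color_class_def)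
          with that(1) sym[OF that(3)] have "c u \<noteq> f v" by (auto simp: color_class_def)
          with True u show ?thesis by (simp add: d_def)
        next
          case False
          with u c_ne show ?thesis by (simp add: d_def)
        qed
      qed
    qed
    have r_inj: "a = b" if "r a = r b" "a \<noteq> i" "b \<noteq> i" for a b
      using that by (simp add: r_def split: if_splits)
    have "r (d v) < k - 1" if "v \<in> verts G" for v
      using d[OF that] i unfolding r_def by presburger
    moreover have "r (d u) \<noteq> r (d v)" if "u \<in> verts G" "v \<in> verts G" "u \<rightarrow> v" for u v
      using r_inj[of "d u" "d v"] d(2)[OF that(1)] d(2)[OF that(2)] dd[OF that] by blast
    ultimately have "proper_coloring G (k - 1) (r \<circ> d)"
      unfolding proper_coloring_def comp_def by blast
    then have "k \<le> k - 1"
      using Least_le[of "\<lambda>k. \<exists>c. proper_coloring G k c" "k - 1"] k_def by auto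
    then show False using i by linarith
  qed
  then show ?thesis by blast
qed

end

theory Submission
  imports Defs
begin

text \<open>
  Delete \<open>x\<close>, of color \<open>z\<close>, from a graph with a \<open>k\<close>-b-coloring. A color class without
  a b-vertex can be dissolved, moving each of its vertices to a color it does not see; the
  other b-vertices stay b-vertices. A former b-vertex of color \<open>i \<noteq> z\<close> that is no longer one
  is a neighbor of \<open>x\<close> and misses the color \<open>z\<close> only. When color \<open>i\<close> is dissolved, such a
  vertex \<open>v\<close> moves to color \<open>z\<close>; it becomes a b-vertex there and repairs all its damaged
  neighbors. So each of the two cliques covering the neighborhood of \<open>x\<close> costs at most
  one color.
\<close>

section \<open>b-colorings over arbitrary sets of colors\<close>

definition proper_on :: "('a, 'b) pre_digraph \<Rightarrow> nat set \<Rightarrow> ('a \<Rightarrow> nat) \<Rightarrow> bool" where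
  "proper_on G C c \<longleftrightarrow>
    c ` verts G \<subseteq> C \<and> (\<forall>u\<in>verts G. \<forall>v\<in>verts G. u \<rightarrow>\<^bsub>G\<^esub> v \<longrightarrow> c u \<noteq> c v)"

text \<open>
  The b-vertices are the case \<open>M = {}\<close>; after the deletion of \<open>x\<close>, the damaged
  b-vertices are those with \<open>M = {c x}\<close>.
\<close>

definition b_vertex_but ::
    "('a, 'b) pre_digraph \<Rightarrow> nat set \<Rightarrow> ('a \<Rightarrow> nat) \<Rightarrow> nat set \<Rightarrow> 'a \<Rightarrow> bool" where
  "b_vertex_but G C c M u \<longleftrightarrow> u \<in> verts G \<and> C - {c u} - M \<subseteq> c ` neighborhood G u"

definition has_b_vertex :: "('a, 'b) pre_digraph \<Rightarrow> nat set \<Rightarrow> ('a \<Rightarrow> nat) \<Rightarrow> nat \<Rightarrow> bool" where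
  "has_b_vertex G C c i \<longleftrightarrow> (\<exists>u. c u = i \<and> b_vertex_but G C c {} u)"

lemma b_coloring_iff:
  "b_coloring G k c \<longleftrightarrow> proper_on G {..<k} c \<and> (\<forall>i<k. has_b_vertex G {..<k} c i)"
proof -
  have "(\<exists>v\<in>color_class G c i. \<forall>j<k. j \<noteq> i \<longrightarrow> (\<exists>w\<in>color_class G c j. v \<rightarrow>\<^bsub>G\<^esub> w))
      \<longleftrightarrow> has_b_vertex G {..<k} c i" for i
    unfolding has_b_vertex_def b_vertex_but_def color_class_def neighborhood_def
    by (auto simp: subset_iff image_iff)
  then show ?thesis
    by (auto simp: b_coloring_def proper_coloring_def proper_on_def)
qed

text \<open>Dissolving a color leaves a gap in the palette, so intermediate colorings use a set
  \<open>C\<close> of colors instead of an initial segment. A bijection closes the gaps once, at the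
  end.\<close>

lemma b_coloring_relabel:
  assumes C: "finite C" and c: "proper_on G C c"
    and b: "\<And>i. i \<in> C \<Longrightarrow> has_b_vertex G C c i"
  shows "\<exists>d. b_coloring G (card C) d"
proof -
  obtain r where r: "bij_betw r C {..<card C}"
    using ex_bij_betw_finite_nat[OF C] atLeast0LessThan by metis
  have inC: "c u \<in> C" if "u \<in> verts G" for u
    using c that by (auto simp: proper_on_def)
  have inj: "r a = r b \<longleftrightarrow> a = b" if "a \<in> C" "b \<in> C" for a b
    using r that by (auto simp: bij_betw_def inj_on_def)
  have "proper_on G {..<card C} (r \<circ> c)"
    using c r inj inC unfolding proper_on_def by (auto simp: bij_betw_def)
  moreover have "has_b_vertex G {..<card C} (r \<circ> c) j" if j: "j < card C" for j
  proof -
    obtain i where i: "i \<in> C" "r i = j"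
      using r j by (metis bij_betw_imp_surj_on imageE lessThan_iff)
    obtain u where u: "c u = i" "u \<in> verts G" "C - {c u} \<subseteq> c ` neighborhood G u"
      using b[OF i(1)] by (auto simp: has_b_vertex_def b_vertex_but_def)
    have "{..<card C} - {r (c u)} \<subseteq> r ` (C - {c u})"
      using r by (auto simp: bij_betw_def)
    also have "\<dots> \<subseteq> r ` c ` neighborhood G u"
      using u(3) by (rule image_mono)
    finally show ?thesis
      using u i unfolding has_b_vertex_def b_vertex_but_def
      by (intro exI[of _ u]) (simp add: image_comp)
  qed
  ultimately show ?thesis by (auto simp: b_coloring_iff)
qed

lemma le_b_chromatic:
  assumes "finite (verts G)" "b_coloring G k c"
  shows "k \<le> b_chromatic G"
  unfolding b_chromatic_def using assms by (auto intro: Max_ge finite_b_colorings)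

lemma (in graph) b_coloring_b_chromatic: "\<exists>c. b_coloring G (b_chromatic G) c"
  using Max_in[OF finite_b_colorings[OF finite_verts]] ex_b_coloring
  unfolding b_chromatic_def by auto

section \<open>Dissolving a color class\<close>

text \<open>No vertex of color \<open>i\<close> is a b-vertex, so each misses some other color of
  \<open>C\<close> and can move there. All moves happen at once, without conflict, since the class
  is independent. The last conclusion keeps track of the target color: it determines where a damaged
  b-vertex must go.\<close>

lemma dissolve_color:
  assumes sym: "\<And>u v. u \<rightarrow>\<^bsub>G\<^esub> v \<Longrightarrow> v \<rightarrow>\<^bsub>G\<^esub> u"
    and c: "proper_on G C c" and no_b: "\<not> has_b_vertex G C c i"
  obtains d where "proper_on G (C - {i}) d"
    and "\<And>u. u \<in> verts G \<Longrightarrow> c u \<noteq> i \<Longrightarrow> d u = c u"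
    and "\<And>u. u \<in> verts G \<Longrightarrow> c u = i \<Longrightarrow> d u \<notin> c ` neighborhood G u"
proof -
  have "\<exists>j. j \<in> C - {i} \<and> j \<notin> c ` neighborhood G u" if "u \<in> verts G" "c u = i" for u
    using no_b that unfolding has_b_vertex_def b_vertex_but_def by blast
  then obtain f where f: "\<And>u. u \<in> verts G \<Longrightarrow> c u = i \<Longrightarrow>
      f u \<in> C - {i} \<and> f u \<notin> c ` neighborhood G u"
    by metis
  define d where "d u = (if c u = i then f u else c u)" for u
  have ne: "d u \<noteq> d v" if "u \<in> verts G" "v \<in> verts G" "u \<rightarrow>\<^bsub>G\<^esub> v" for u v
  proof -
    have "c u \<noteq> c v" "c v \<in> c ` neighborhood G u" "c u \<in> c ` neighborhood G v"
      using c that sym[OF that(3)] by (auto simp: proper_on_def neighborhood_def)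
    then show ?thesis
      using f[OF that(1)] f[OF that(2)] by (auto simp: d_def)
  qed
  show thesis
  proof
    show "proper_on G (C - {i}) d"
      using c f ne by (auto simp: proper_on_def d_def)
  qed (use f in \<open>auto simp: d_def\<close>)
qed

text \<open>Only vertices of color \<open>i\<close> are recolored, so \<open>i\<close> is the only
  color that a neighborhood can lose.\<close>

lemma b_vertex_but_dissolve:
  assumes "b_vertex_but G C c M u" and "c u \<noteq> i"
    and "\<And>w. w \<in> verts G \<Longrightarrow> c w \<noteq> i \<Longrightarrow> d w = c w"
  shows "b_vertex_but G (C - {i}) d M u"
proof -
  have "c ` neighborhood G u - {i} \<subseteq> d ` neighborhood G u"
    using assms(3) by (force simp: neighborhood_def)
  then show ?thesis
    using assms by (auto simp: b_vertex_but_def)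
qed

lemma has_b_vertex_dissolve:
  assumes "has_b_vertex G C c j" and "j \<noteq> i"
    and "\<And>w. w \<in> verts G \<Longrightarrow> c w \<noteq> i \<Longrightarrow> d w = c w"
  shows "has_b_vertex G (C - {i}) d j"
proof -
  obtain u where u: "c u = j" "b_vertex_but G C c {} u"
    using assms(1) by (auto simp: has_b_vertex_def)
  moreover have "d u = j"
    using assms u by (auto simp: b_vertex_but_def)
  ultimately show ?thesis
    using b_vertex_but_dissolve[of G C c "{}" u i d] assms by (auto simp: has_b_vertex_def)
qed

section \<open>Repairing damaged colors, one clique at a time\<close>

lemma dissolve_damaged_color:
  assumes sym: "\<And>u v. u \<rightarrow>\<^bsub>G\<^esub> v \<Longrightarrow> v \<rightarrow>\<^bsub>G\<^esub> u"
    and c: "proper_on G C c" and no_b: "\<not> has_b_vertex G C c i" and "i \<noteq> z"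
    and v: "c v = i" "b_vertex_but G C c {z} v"
  obtains d where "proper_on G (C - {i}) d"
    and "\<And>u. u \<in> verts G \<Longrightarrow> c u \<noteq> i \<Longrightarrow> d u = c u"
    and "has_b_vertex G (C - {i}) d z"
    and "\<And>u. b_vertex_but G C c {z} u \<Longrightarrow> c u \<noteq> i \<Longrightarrow> u \<rightarrow>\<^bsub>G\<^esub> v \<Longrightarrow> b_vertex_but G (C - {i}) d {} u"
proof -
  obtain d where d: "proper_on G (C - {i}) d"
    "\<And>u. u \<in> verts G \<Longrightarrow> c u \<noteq> i \<Longrightarrow> d u = c u"
    "\<And>u. u \<in> verts G \<Longrightarrow> c u = i \<Longrightarrow> d u \<notin> c ` neighborhood G u"
    using dissolve_color[OF sym c no_b] by metis
  have vG: "v \<in> verts G"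
    using v by (simp add: b_vertex_but_def)
  \<comment> \<open>The new color of \<open>v\<close> lies in \<open>C - {i}\<close> and was not
    seen by \<open>v\<close>, but \<open>v\<close> sees all of this set except possibly
    \<open>z\<close>.\<close>
  have dv: "d v = z"
    using d(1) d(3)[OF vG v(1)] v vG unfolding proper_on_def b_vertex_but_def by blast
  \<comment> \<open>In contrast to \<open>b_vertex_but_dissolve\<close>, this also covers
    \<open>c u = i\<close>, because it is applied to \<open>v\<close> itself.\<close>
  have keep: "C - {i} - {c u} - {z} \<subseteq> d ` neighborhood G u" if "b_vertex_but G C c {z} u" for u
  proof -
    have "c ` neighborhood G u - {i} \<subseteq> d ` neighborhood G u"
      using d(2) by (force simp: neighborhood_def)
    then show ?thesis
      using that by (auto simp: b_vertex_but_def)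
  qed
  show thesis
  proof
    show "has_b_vertex G (C - {i}) d z"
      using keep[OF v(2)] v vG dv unfolding has_b_vertex_def b_vertex_but_def
      by (intro exI[of _ v]) auto
    show "b_vertex_but G (C - {i}) d {} u"
      if u: "b_vertex_but G C c {z} u" "c u \<noteq> i" "u \<rightarrow>\<^bsub>G\<^esub> v" for u
    proof -
      have "z \<in> d ` neighborhood G u"
        using dv vG u(3) by (force simp: neighborhood_def)
      then show ?thesis
        using keep[OF u(1)] u d(2)[of u] unfolding b_vertex_but_def by auto
    qed
  qed (use d in auto)
qed

text \<open>The recolored \<open>v\<close> serves color \<open>z\<close> and, being adjacent to the
  rest of \<open>K\<close>, repairs every damaged vertex of \<open>K\<close> whose color is not
  \<open>i\<close>. Damage can survive only in \<open>L\<close>. The conclusion records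
  \<open>j \<noteq> z\<close> so that the lemma can be applied again to a surviving damaged
  color.\<close>

lemma dissolve_clique:
  assumes sym: "\<And>u v. u \<rightarrow>\<^bsub>G\<^esub> v \<Longrightarrow> v \<rightarrow>\<^bsub>G\<^esub> u"
    and c: "proper_on G C c" and no_b: "\<not> has_b_vertex G C c i" and iz: "i \<noteq> z"
    and K: "clique G K" and v: "v \<in> K" "c v = i" "b_vertex_but G C c {z} v"
    and damaged: "\<And>j. j \<in> C - {z} \<Longrightarrow> has_b_vertex G C c j \<or>
      (\<exists>u\<in>K \<union> L. c u = j \<and> b_vertex_but G C c {z} u)"
  shows "\<exists>d. proper_on G (C - {i}) d \<and> (\<forall>j\<in>C - {i}. has_b_vertex G (C - {i}) d j \<or>
      (\<exists>u\<in>L. d u = j \<and> j \<noteq> z \<and> b_vertex_but G (C - {i}) d {z} u))"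
proof -
  obtain d where d: "proper_on G (C - {i}) d"
    "\<And>u. u \<in> verts G \<Longrightarrow> c u \<noteq> i \<Longrightarrow> d u = c u"
    "has_b_vertex G (C - {i}) d z"
    "\<And>u. b_vertex_but G C c {z} u \<Longrightarrow> c u \<noteq> i \<Longrightarrow> u \<rightarrow>\<^bsub>G\<^esub> v \<Longrightarrow> b_vertex_but G (C - {i}) d {} u"
    using dissolve_damaged_color[OF sym c no_b iz v(2,3)] by metis
  show ?thesis
  proof (intro exI[of _ d] conjI ballI)
    fix j
    assume j: "j \<in> C - {i}"
    show "has_b_vertex G (C - {i}) d j \<or>
      (\<exists>u\<in>L. d u = j \<and> j \<noteq> z \<and> b_vertex_but G (C - {i}) d {z} u)"
    proof (cases "j = z \<or> has_b_vertex G C c j")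
      case True
      then show ?thesis
        using d(3) j has_b_vertex_dissolve[of G C c j i d] d(2) by auto
    next
      case False
      then obtain u where u: "u \<in> K \<union> L" "c u = j" "b_vertex_but G C c {z} u"
        using damaged[of j] j by auto
      then have du: "d u = j"
        using d(2)[of u] j by (auto simp: b_vertex_but_def)
      show ?thesis
      proof (cases "u \<in> K")
        case True
        \<comment> \<open>\<open>u\<close> and \<open>v\<close> have different colors, hence are
          distinct members of the clique \<open>K\<close>.\<close>
        then have "u \<rightarrow>\<^bsub>G\<^esub> v"
          using K v u(2) j by (auto simp: clique_def)
        then show ?thesis
          using d(4)[OF u(3)] u(2) du j by (auto simp: has_b_vertex_def)
      next
        case False
        then show ?thesis
          using u du j \<open>\<not> (j = z \<or> has_b_vertex G C c j)\<close>
            b_vertex_but_dissolve[of G C c "{z}" u i d] d(2) by auto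
      qed
    qed
  qed (rule d(1))
qed

text \<open>Here \<open>G\<close> is the graph after the deletion and \<open>z\<close> the color of
  the deleted vertex. Nothing is assumed about b-vertices of color \<open>z\<close>, since the
  deleted vertex may have been the only one.\<close>

lemma b_chromatic_ge_damaged:
  assumes fin: "finite (verts G)" and C: "finite C"
    and sym: "\<And>u v. u \<rightarrow>\<^bsub>G\<^esub> v \<Longrightarrow> v \<rightarrow>\<^bsub>G\<^esub> u"
    and c: "proper_on G C c"
    and K: "clique G K" and L: "clique G L"
    and damaged: "\<And>j. j \<in> C - {z} \<Longrightarrow> has_b_vertex G C c j \<or>
      (\<exists>u\<in>K \<union> L. c u = j \<and> b_vertex_but G C c {z} u)"
  shows "card C - 2 \<le> b_chromatic G"
proof -
  have finish: "card A \<le> b_chromatic G"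
    if "A \<subseteq> C" "proper_on G A d" "\<And>j. j \<in> A \<Longrightarrow> has_b_vertex G A d j" for A d
    using b_coloring_relabel[OF finite_subset[OF that(1) C] that(2,3)] le_b_chromatic[OF fin]
    by blast
  \<comment> \<open>\<open>A\<close> is the clique containing the first damaged vertex and
    \<open>B\<close> the other one; the roles of \<open>K\<close> and \<open>L\<close> depend on
    where that vertex lies.\<close>
  have two_cliques: "card C - 2 \<le> b_chromatic G"
    if no_b: "\<not> has_b_vertex G C c i" and iz: "i \<noteq> z" and A: "clique G A" and B: "clique G B"
      and v: "v \<in> A" "c v = i" "b_vertex_but G C c {z} v"
      and AB: "\<And>j. j \<in> C - {z} \<Longrightarrow> has_b_vertex G C c j \<or>
        (\<exists>u\<in>A \<union> B. c u = j \<and> b_vertex_but G C c {z} u)"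
    for i v A B
  proof -
    define C1 where "C1 = C - {i}"
    obtain d where d: "proper_on G C1 d"
      "\<forall>j\<in>C1. has_b_vertex G C1 d j \<or>
        (\<exists>u\<in>B. d u = j \<and> j \<noteq> z \<and> b_vertex_but G C1 d {z} u)"
      using dissolve_clique[OF sym c no_b iz A v AB] unfolding C1_def by blast
    show ?thesis
    proof (cases "\<forall>j\<in>C1. has_b_vertex G C1 d j")
      case True
      then have "card C1 \<le> b_chromatic G"
        using finish[of C1 d] d(1) by (auto simp: C1_def)
      moreover have "card C - 1 \<le> card C1"
        using C by (simp add: C1_def card_Diff_singleton_if)
      ultimately show ?thesis by linarith
    next
      case False
      then obtain j w where w: "\<not> has_b_vertex G C1 d j" "j \<noteq> z"
          "w \<in> B" "d w = j" "b_vertex_but G C1 d {z} w"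
        using d(2) by blast
      have damaged1: "has_b_vertex G C1 d l \<or> (\<exists>u\<in>B \<union> {}. d u = l \<and> b_vertex_but G C1 d {z} u)"
        if "l \<in> C1 - {z}" for l
        using d(2) that by blast
      obtain e where e: "proper_on G (C1 - {j}) e"
          "\<forall>l\<in>C1 - {j}. has_b_vertex G (C1 - {j}) e l \<or>
            (\<exists>u\<in>{}. e u = l \<and> l \<noteq> z \<and> b_vertex_but G (C1 - {j}) e {z} u)"
        \<comment> \<open>The second clique is now empty, so no damage can remain: all colors left
          have b-vertices.\<close>
        using dissolve_clique[OF sym d(1) w(1,2) B w(3-5) damaged1] by blast
      have "card (C1 - {j}) \<le> b_chromatic G"
        using finish[of "C1 - {j}" e] e unfolding C1_def by blast
      moreover have "card C - 2 \<le> card (C1 - {j})"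
        using C by (auto simp: C1_def card_Diff_singleton_if)
      ultimately show ?thesis by linarith
    qed
  qed
  show ?thesis
  proof (cases "\<exists>i\<in>C - {z}. \<not> has_b_vertex G C c i")
    case True
    then obtain i u where iu: "\<not> has_b_vertex G C c i" "i \<noteq> z" "u \<in> K \<union> L" "c u = i"
        "b_vertex_but G C c {z} u"
      using damaged by blast
    have damaged': "has_b_vertex G C c j \<or> (\<exists>u\<in>L \<union> K. c u = j \<and> b_vertex_but G C c {z} u)"
      if "j \<in> C - {z}" for j
      using damaged[OF that] by blast
    from iu(3) show ?thesis
    proof
      assume "u \<in> K"
      then show ?thesis
        by (rule two_cliques[OF iu(1,2) K L _ iu(4,5) damaged])
    next
      assume "u \<in> L"
      then show ?thesis
        by (rule two_cliques[OF iu(1,2) L K _ iu(4,5) damaged'])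
    qed
  next
    \<comment> \<open>Only color \<open>z\<close> can lack a b-vertex; dissolving it costs a single
      color.\<close>
    case False
    show ?thesis
    proof (cases "has_b_vertex G C c z")
      case True
      then have "card C \<le> b_chromatic G"
        using finish[OF subset_refl c] False by blast
      then show ?thesis by linarith
    next
      case no_b: False
      obtain d where d: "proper_on G (C - {z}) d"
          "\<And>u. u \<in> verts G \<Longrightarrow> c u \<noteq> z \<Longrightarrow> d u = c u"
          "\<And>u. u \<in> verts G \<Longrightarrow> c u = z \<Longrightarrow> d u \<notin> c ` neighborhood G u"
        using dissolve_color[OF sym c no_b] by metis
      have "card (C - {z}) \<le> b_chromatic G"
      proof (rule finish[OF _ d(1)])
        show "has_b_vertex G (C - {z}) d j" if "j \<in> C - {z}" for j
        proof (rule has_b_vertex_dissolve[OF _ _ d(2)])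
          show "has_b_vertex G C c j" "j \<noteq> z"
            using that False by blast+
        qed
      qed auto
      then show ?thesis
        using C by (simp add: card_Diff_singleton_if split: if_splits)
    qed
  qed
qed

section \<open>Deleting a vertex from a quasi-line graph\<close>

theorem theorem4:
  fixes G :: "('a, 'b) pre_digraph"
  assumes "graph G"
    and "quasi_line G"
    and "x \<in> verts G"
  shows "int (b_chromatic (pre_digraph.del_vert G x)) \<ge> int (b_chromatic G) - 2"
proof -
  interpret graph G by fact
  define H where "H = del_vert x"
  have verts_H: "verts H = verts G - {x}"
    by (simp add: H_def verts_del_vert)
  have adj_H: "u \<rightarrow>\<^bsub>H\<^esub> v \<longleftrightarrow> u \<noteq> x \<and> v \<noteq> x \<and> u \<rightarrow>\<^bsub>G\<^esub> v" for u v
    by (auto simp: H_def arcs_ends_def arc_to_ends_def arcs_del_vert tail_del_vert head_del_vert)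
  have sym: "v \<rightarrow>\<^bsub>G\<^esub> u" if "u \<rightarrow>\<^bsub>G\<^esub> v" for u v
    using that arcs_ends_symmetric[OF sym_arcs] by blast
  have nb_H: "neighborhood H u = neighborhood G u - {x}" if "u \<noteq> x" for u
    using that by (auto simp: neighborhood_def verts_H adj_H)
  obtain K L where KL: "clique G K" "clique G L" "neighborhood G x \<subseteq> K \<union> L"
    using assms by (auto simp: quasi_line_def)
  define k where "k = b_chromatic G"
  obtain c where c: "proper_on G {..<k} c" "\<And>i. i < k \<Longrightarrow> has_b_vertex G {..<k} c i"
    using b_coloring_b_chromatic by (auto simp: k_def b_coloring_iff)
  have "card {..<k} - 2 \<le> b_chromatic H"
  proof (rule b_chromatic_ge_damaged)
    show "v \<rightarrow>\<^bsub>H\<^esub> u" if "u \<rightarrow>\<^bsub>H\<^esub> v" for u v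
      using that sym[of u v] by (simp add: adj_H)
    show "proper_on H {..<k} c"
      using c(1) by (auto simp: proper_on_def verts_H adj_H)
    show "clique H (K - {x})" "clique H (L - {x})"
      using KL by (auto simp: clique_def verts_H adj_H)
    fix j
    assume j: "j \<in> {..<k} - {c x}"
    then obtain u where u: "c u = j" "u \<in> verts G" "{..<k} - {c u} \<subseteq> c ` neighborhood G u"
      using c(2)[of j] by (auto simp: has_b_vertex_def b_vertex_but_def)
    \<comment> \<open>The b-vertex survives the deletion because its color differs from that of
      \<open>x\<close>.\<close>
    have ux: "u \<noteq> x"
      using u(1) j by blast
    show "has_b_vertex H {..<k} c j \<or>
      (\<exists>u\<in>(K - {x}) \<union> (L - {x}). c u = j \<and> b_vertex_but H {..<k} c {c x} u)"
    \<comment> \<open>A neighbor of \<open>x\<close> lies in one of the two cliques and can lose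
      only the color \<open>c x\<close>; any other b-vertex keeps its whole neighborhood.\<close>
    proof (cases "u \<rightarrow>\<^bsub>G\<^esub> x")
      case True
      have "u \<in> neighborhood G x"
        using u(2) sym[OF True] by (simp add: neighborhood_def)
      then have "u \<in> K \<union> L"
        using KL(3) by blast
      moreover have "b_vertex_but H {..<k} c {c x} u"
        using u(2,3) ux unfolding b_vertex_but_def verts_H nb_H[OF ux] by blast
      ultimately show ?thesis
        using u(1) ux by blast
    next
      case False
      then have "x \<notin> neighborhood G u"
        by (simp add: neighborhood_def)
      then have "neighborhood H u = neighborhood G u"
        by (simp add: nb_H[OF ux])
      then have "b_vertex_but H {..<k} c {} u"
        using u(2,3) ux by (simp add: b_vertex_but_def verts_H)
      then show ?thesis
        using u(1) unfolding has_b_vertex_def by blast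
    qed
  qed (simp_all add: verts_H)
  \<comment> \<open>Truncated subtraction on naturals never falls below integer subtraction, so the
    bound transfers.\<close>
  then show ?thesis
    by (simp add: H_def k_def)
qed

end
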